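(* Let $W$ be a mixing matrix satisfying the assumption on $W$ stated in the context, let $\gamma\in(0,1]$, $\eta>0$, and let $\{x_{i,k}\}$ be generated by $$x_{i,k+1}=\mathcal P_{\mathcal M}\Big((1-\gamma)x_{i,k}+\gamma\sum_{j=1}^n W_{ij}x_{j,k}+\eta d_{i,k}\Big),\qquad i=1,\dots,n,\ k\ge 0,$$ where $d_{i,k}\in\mathbb R^{d\times r}$ are the search directions. Suppose that $\mathbf x_0\in\mathcal N(\delta)$ with $\delta<\min\{R\gamma(1-\sigma_2),\frac R4\}$, and that for all $k\ge 0$ $$\|\eta\mathbf d_k\|\le\min\Big\{\frac R4,\ \frac{R\gamma(1-\sigma_2)-\delta}{2(R-\delta)}\,\delta\Big\}.$$ Then $\mathbf x_k\in\mathcal N(\delta)$ for all $k\ge 0$.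
   Context: $\mathcal M\subset\mathbb R^{d\times r}$ is a compact smooth embedded submanifold, $\|\cdot\|$ is the Euclidean (Frobenius) norm, $\mathrm{dist}(x,\mathcal M)=\inf_{y\in\mathcal M}\|y-x\|$, and $\mathcal P_{\mathcal M}(x)=\arg\min_{y\in\mathcal M}\|y-x\|$ is the nearest-point projection (any nearest point is taken where it is not unique). Throughout, $\mathcal M$ is $R$-proximally smooth for some $R>0$: $\mathcal P_{\mathcal M}(x)$ is a singleton whenever $\mathrm{dist}(x,\mathcal M)<R$. A known consequence is that for every $\tau\in(0,R)$, $\|\mathcal P_{\mathcal M}(x)-\mathcal P_{\mathcal M}(y)\|\le\frac{R}{R-\tau}\|x-y\|$ for all $x,y$ at distance at most $\tau$ from $\mathcal M$. Assumption on $W\in\mathbb R^{n\times n}$ (the mixing matrix of an undirected network on $n$ agents, with $W_{ij}>0$ if $(i,j)$ is an edge and, for $i\neq j$, $W_{ij}=0$ otherwise): $W$ is doubly stochastic, with $W=W^\top$; $W_{ij}\ge 0$ and $0<W_{ii}<1$ for all $i,j$; the eigenvalues of $W$ lie in $(-1,1]$; and the second largest singular value $\sigma_2$ of $W$ lies in $[0,1)$. Notation: for $x_1,\dots,x_n\in\mathcal M$, $\mathbf x=[x_1^\top,\dots,x_n^\top]^\top\in\mathbb R^{nd\times r}$ (an element of $\mathcal M^n$), $\hat x=\frac1n\sum_i x_i$, $\bar x\in\mathcal P_{\mathcal M}(\hat x)$, and $\bar{\mathbf x}=[\bar x^\top,\dots,\bar x^\top]^\top$ ($n$ copies). With iteration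 index, $\mathbf x_k=[x_{1,k}^\top,\dots,x_{n,k}^\top]^\top$ and $\mathbf d_k=[d_{1,k}^\top,\dots,d_{n,k}^\top]^\top$. The neighborhood is $\mathcal N(\delta)=\{\mathbf x\in\mathcal M^n:\|\mathbf x-\bar{\mathbf x}\|\le\delta\}$. *)

theory Defs
  imports "HOL-Analysis.Analysis" "HOL-Library.Multiset"
begin

section \<open>Smooth embedded submanifolds of a Euclidean space\<close>

text \<open>
  \<open>Ck_on k f S\<close> is meant for open \<open>S\<close>.  Instead of iterating the total derivative, whose codomain
  changes at every step, it takes directional derivatives one direction at a time; in finite
  dimension this is the usual notion of \<open>k\<close>-fold continuous differentiability.
\<close>

primrec Ck_on :: "nat \<Rightarrow> ('a::euclidean_space \<Rightarrow> 'b::euclidean_space) \<Rightarrow> 'a set \<Rightarrow> bool" where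
  "Ck_on 0 f S \<longleftrightarrow> continuous_on S f"
| "Ck_on (Suc k) f S \<longleftrightarrow>
     (\<forall>x\<in>S. f differentiable (at x)) \<and> (\<forall>v. Ck_on k (\<lambda>x. frechet_derivative f (at x) v) S)"

definition smooth_on :: "('a::euclidean_space \<Rightarrow> 'b::euclidean_space) \<Rightarrow> 'a set \<Rightarrow> bool" where
  "smooth_on f S \<longleftrightarrow> (\<forall>k. Ck_on k f S)"

definition diffeomorphism ::
    "'a::euclidean_space set \<Rightarrow> 'b::euclidean_space set \<Rightarrow> ('a \<Rightarrow> 'b) \<Rightarrow> ('b \<Rightarrow> 'a) \<Rightarrow> bool" where
  "diffeomorphism U V f g \<longleftrightarrow>
     open U \<and> open V \<and> homeomorphism U V f g \<and> smooth_on f U \<and> smooth_on g V"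

text \<open>Slice charts of the ambient space, with one dimension \<open>m\<close> for the whole submanifold.\<close>

definition smooth_embedded_submanifold :: "'a::euclidean_space set \<Rightarrow> bool" where
  "smooth_embedded_submanifold M \<longleftrightarrow>
     (\<exists>m. \<forall>p\<in>M. \<exists>U V f g L.
        p \<in> U \<and> diffeomorphism U V f g \<and>
        subspace (L :: 'a set) \<and> dim L = m \<and> f ` (U \<inter> M) = V \<inter> L)"

section \<open>Nearest-point projection and proximal smoothness\<close>

text \<open>The projection is set-valued, so that a hypothesis \<open>y \<in> nearest_points M x\<close> admits
  any nearest point.\<close>

definition nearest_points :: "'a::euclidean_space set \<Rightarrow> 'a \<Rightarrow> 'a set" where
  "nearest_points M x = {y. is_arg_min (\<lambda>y. norm (y - x)) (\<lambda>y. y \<in> M) y}"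

definition proximally_smooth :: "real \<Rightarrow> 'a::euclidean_space set \<Rightarrow> bool" where
  "proximally_smooth R M \<longleftrightarrow> (\<forall>x. infdist x M < R \<longrightarrow> is_singleton (nearest_points M x))"

section \<open>Mixing matrices\<close>

definition doubly_stochastic :: "real^'n^'n \<Rightarrow> bool" where
  "doubly_stochastic W \<longleftrightarrow>
     (\<forall>i j. 0 \<le> W $ i $ j) \<and> (\<forall>i. (\<Sum>j\<in>UNIV. W $ i $ j) = 1) \<and> (\<forall>j. (\<Sum>i\<in>UNIV. W $ i $ j) = 1)"

definition eigenspace :: "real^'n^'n \<Rightarrow> real \<Rightarrow> (real^'n) set" where
  "eigenspace A c = {v. A *v v = c *\<^sub>R v}"

definition eigenvalue :: "real^'n^'n \<Rightarrow> real \<Rightarrow> bool" where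
  "eigenvalue A c \<longleftrightarrow> (\<exists>v. v \<noteq> 0 \<and> v \<in> eigenspace A c)"

text \<open>
  The square roots of the eigenvalues of \<open>A\<^sup>T A\<close>, with multiplicity.  As \<open>A\<^sup>T A\<close> is symmetric, the
  multiplicity of an eigenvalue is the dimension of its eigenspace.  The sum below is over a
  finite set, and the multiset has \<open>CARD('n)\<close> elements.
\<close>

definition singular_values :: "real^'n^'n \<Rightarrow> real multiset" where
  "singular_values A =
     (\<Sum>s \<in> {s. 0 \<le> s \<and> eigenvalue (transpose A ** A) (s\<^sup>2)}.
        replicate_mset (dim (eigenspace (transpose A ** A) (s\<^sup>2))) s)"

text \<open>Meaningful for \<open>CARD('n) \<ge> 2\<close> only; a \<open>1 \<times> 1\<close> matrix is never a mixing matrix below.\<close>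

definition second_singular_value :: "real^'n^'n \<Rightarrow> real" where
  "second_singular_value A = rev (sorted_list_of_multiset (singular_values A)) ! 1"

text \<open>\<open>E\<close> is the edge relation of the network; whether it contains loops is immaterial.\<close>

definition mixing_matrix :: "('n \<Rightarrow> 'n \<Rightarrow> bool) \<Rightarrow> real^'n^'n \<Rightarrow> bool" where
  "mixing_matrix E W \<longleftrightarrow>
     symp E \<and>
     (\<forall>i j. E i j \<longrightarrow> 0 < W $ i $ j) \<and>
     (\<forall>i j. i \<noteq> j \<and> \<not> E i j \<longrightarrow> W $ i $ j = 0) \<and>
     doubly_stochastic W \<and>
     W = transpose W \<and>
     (\<forall>i. 0 < W $ i $ i \<and> W $ i $ i < 1) \<and>
     (\<forall>c. eigenvalue W c \<longrightarrow> -1 < c \<and> c \<le> 1) \<and>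
     0 \<le> second_singular_value W \<and> second_singular_value W < 1"

section \<open>Stacked iterates\<close>

text \<open>
  The stack of blocks \<open>x\<^sub>i \<in> 'a\<close>, \<open>i \<in> 'n\<close>, is the vector \<open>x :: 'a^'n\<close>; its norm is the square root of
  the sum of the \<open>(norm (x $ i))\<^sup>2\<close>, which for matrix blocks is the Frobenius norm of the stacked matrix.
\<close>

definition average :: "('a::euclidean_space)^'n \<Rightarrow> 'a" where
  "average x = (1 / real CARD('n)) *\<^sub>R (\<Sum>i\<in>UNIV. x $ i)"

text \<open>
  The distance from \<open>x\<close> to \<open>(\<chi> i. xbar)\<close> is the same for all nearest points \<open>xbar\<close> of the average,
  since \<open>\<Sum>\<^sub>i \<parallel>x\<^sub>i - y\<parallel>\<^sup>2 = \<Sum>\<^sub>i \<parallel>x\<^sub>i - average x\<parallel>\<^sup>2 + n \<parallel>average x - y\<parallel>\<^sup>2\<close>.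
  Hence it does not matter which one is taken.
\<close>

definition neighborhood :: "'a::euclidean_space set \<Rightarrow> real \<Rightarrow> ('a^'n) set" where
  "neighborhood M \<delta> =
     {x. (\<forall>i. x $ i \<in> M) \<and>
         (\<exists>xbar \<in> nearest_points M (average x). norm (x - (\<chi> i. xbar)) \<le> \<delta>)}"

end

theory Submission
  imports Defs
begin

text \<open>
  The argument weighs a contraction against an expansion.  Write \<open>c = \<gamma> (1 - \<sigma>\<^sub>2)\<close>.

  Contraction.  Mixing with \<open>W\<close> fixes the average of a stack and shrinks the deviation from it by the
  factor \<open>\<sigma>\<^sub>2\<close> (\<open>mixing_contraction\<close>), so the relaxed mixing step shrinks it by \<open>1 - c\<close>.  Since
  \<open>\<sigma>\<^sub>2\<close> is given as an entry in the sorted list of singular values, this takes the part of the spectral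
  theorem that identifies the norm of \<open>W\<close> on the zero-sum vectors as a singular value other than the
  one contributed by the constant vectors (\<open>gram_eigenvector_exists\<close>, \<open>second_singular_value_ge\<close>).

  Expansion.  Projecting back to \<open>M\<close> may increase distances, but at distance at most \<open>\<tau> < R\<close> from \<open>M\<close>
  only by the factor \<open>R / (R - \<tau>)\<close> (\<open>nearest_points_lipschitz\<close>).  The passage from unique nearest
  points to this estimate goes through the extension of normals: a nearest point \<open>p\<close> of \<open>x\<close> remains a
  nearest point all along the ray from \<open>p\<close> through \<open>x\<close>, up to distance \<open>R\<close>.  Thus \<open>M\<close> avoids an open ball of
  radius \<open>R\<close> touching it at \<open>p\<close>, which bounds the angle at \<open>p\<close> between \<open>x - p\<close> and any chord of \<open>M\<close>.  That a
  normal segment can be prolonged at all (\<open>nearest_point_extends\<close>) is a fixed-point argument.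

  Balance.  Let \<open>e\<close> be the norm of the stacked perturbation.  Then one step maps the distance \<open>\<delta>\<close> to the consensus
  point to at most \<open>R / (R - (\<delta> + e)) * ((1 - c) * \<delta> + e)\<close>, and the bound on \<open>e\<close> is what makes this at
  most \<open>\<delta>\<close> (\<open>expansion_absorbed\<close>, \<open>neighborhood_step\<close>).
\<close>

section \<open>Nearest points\<close>

lemma nearest_points_iff:
  "p \<in> nearest_points M x \<longleftrightarrow> p \<in> M \<and> (\<forall>y\<in>M. dist x p \<le> dist x y)"
  by (auto simp: nearest_points_def is_arg_min_linorder dist_norm norm_minus_commute)

lemma nearest_points_iff_infdist:
  "p \<in> nearest_points M x \<longleftrightarrow> p \<in> M \<and> dist x p = infdist x M"
proof
  assume p: "p \<in> nearest_points M x"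
  then have "dist x p \<le> infdist x M"
    by (metis cINF_greatest empty_iff infdist_notempty nearest_points_iff)
  with p show "p \<in> M \<and> dist x p = infdist x M"
    by (auto simp: nearest_points_iff intro: antisym infdist_le)
qed (auto simp: nearest_points_iff infdist_le)

lemma nearest_points_nonempty:
  fixes M :: "'a::euclidean_space set"
  assumes "compact M" "M \<noteq> {}"
  obtains p where "p \<in> nearest_points M x"
  using infdist_attains_inf[of M x] assms compact_imp_closed
  by (metis nearest_points_iff_infdist)

lemma nearest_points_unique:
  assumes "proximally_smooth R M" "infdist x M < R"
    and "p \<in> nearest_points M x" "q \<in> nearest_points M x"
  shows "p = q"
  using assms by (metis is_singletonE proximally_smooth_def singletonD)

lemma nearest_points_along_segment:
  fixes w q :: "'a::euclidean_space"
  assumes q: "q \<in> nearest_points M w" and z: "z \<in> closed_segment w q"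
  shows "q \<in> nearest_points M z"
proof -
  have split: "dist w q = dist w z + dist z q"
    using z between_mem_segment by (metis between)
  have "dist z q \<le> dist z y" if "y \<in> M" for y
  proof -
    have "dist w q \<le> dist w y"
      using q that by (auto simp: nearest_points_iff)
    then show ?thesis
      using split dist_triangle[of w y z] by simp
  qed
  with q show ?thesis
    by (auto simp: nearest_points_iff)
qed

text \<open>The graph of a nearest-point selection on a set where nearest points are unique is the closed
  set of pairs \<open>(z, y)\<close> with \<open>dist z y = infdist z M\<close>; as the values lie in the compact set
  \<open>M\<close>, a closed graph suffices for continuity.\<close>

lemma continuous_on_nearest_point:
  fixes M :: "'a::euclidean_space set"
  assumes M: "compact M" and P: "\<And>z. z \<in> S \<Longrightarrow> nearest_points M z = {P z}"
  shows "continuous_on S P"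
proof -
  have PM: "P \<in> S \<rightarrow> M"
    using P nearest_points_iff by blast
  have "(\<lambda>z. (z, P z)) ` S = (S \<times> M) \<inter> {a. dist (fst a) (snd a) = infdist (fst a) M}"
  proof -
    have "y = P z \<longleftrightarrow> y \<in> M \<and> dist z y = infdist z M" if "z \<in> S" for z y
      using P[OF that] nearest_points_iff_infdist[of y M z] by auto
    then show ?thesis
      by (auto simp: image_iff) blast+
  qed
  moreover have "closed {a::'a \<times> 'a. dist (fst a) (snd a) = infdist (fst a) M}"
    by (intro closed_Collect_eq continuous_intros)
  ultimately show ?thesis
    by (auto simp: continuous_closed_graph_eq[OF M PM] closedin_closed)
qed

section \<open>Projection onto a proximally smooth set\<close>

text \<open>A nearest point \<open>p\<close> of \<open>z\<close> stays nearest a little further out along the ray from \<open>p\<close> through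
  \<open>z\<close>.  It is enough to find a point \<open>w \<noteq> z\<close> such that \<open>z\<close> lies between \<open>w\<close> and its nearest point
  \<open>P w\<close>: then \<open>P w\<close> is also nearest to \<open>z\<close>, so it equals \<open>p\<close>, and \<open>w\<close> lies on the ray beyond \<open>z\<close>.
  Such a \<open>w\<close> at distance \<open>\<epsilon>\<close> from \<open>z\<close> is a fixed point of \<open>w \<mapsto> z + \<epsilon> n(w)\<close>, where \<open>n(w)\<close> is the
  unit vector in the direction of \<open>w - P w\<close>, and Brouwer's theorem provides one.\<close>

lemma nearest_point_extends:
  fixes M :: "'a::euclidean_space set"
  assumes M: "compact M" and R: "proximally_smooth R M"
    and p: "p \<in> nearest_points M z" and zp: "z = p + T *\<^sub>R u" and u: "norm u = 1"
    and e: "0 < \<epsilon>" "2 * \<epsilon> \<le> T" "T + \<epsilon> < R"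
  shows "p \<in> nearest_points M (p + (T + \<epsilon>) *\<^sub>R u)"
proof -
  define P where "P = (\<lambda>w. the_elem (nearest_points M w))"
  define n where "n = (\<lambda>w. (w - P w) /\<^sub>R norm (w - P w))"
  have "dist z p = T"
    using u e by (simp add: zp dist_norm)
  then have dz: "infdist z M = T"
    using p by (auto simp: nearest_points_iff_infdist)
  have near: "T - \<epsilon> \<le> infdist w M" "infdist w M < R" if "w \<in> cball z \<epsilon>" for w
    using infdist_triangle_abs[of z M w] dz that e by auto
  have P: "nearest_points M w = {P w}" if "w \<in> cball z \<epsilon>" for w
    using R near(2)[OF that] by (simp add: proximally_smooth_def is_singleton_the_elem P_def)
  have P_in: "P w \<in> nearest_points M w" if "w \<in> cball z \<epsilon>" for w
    using P[OF that] by simp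
  have far: "\<epsilon> \<le> norm (w - P w)" if "w \<in> cball z \<epsilon>" for w
    using P_in[OF that] near(1)[OF that] e by (simp add: nearest_points_iff_infdist dist_norm)
  have norm_n: "norm (n w) = 1" if "w \<in> cball z \<epsilon>" for w
    using far[OF that] e(1) by (cases "w = P w") (simp_all add: n_def)
  have contP: "continuous_on (cball z \<epsilon>) P"
    using continuous_on_nearest_point[OF M P] .
  have contn: "continuous_on (cball z \<epsilon>) (\<lambda>w. z + \<epsilon> *\<^sub>R n w)"
    unfolding n_def by (intro continuous_intros contP) (use far e in force)
  obtain w where w: "w \<in> cball z \<epsilon>" and fixpt: "z + \<epsilon> *\<^sub>R n w = w"
  proof (rule brouwer_ball[OF e(1) contn])
    show "(\<lambda>w. z + \<epsilon> *\<^sub>R n w) \<in> cball z \<epsilon> \<rightarrow> cball z \<epsilon>"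
      using norm_n e by (auto simp: dist_norm)
  qed
  define c where "c = norm (w - P w)"
  have c: "\<epsilon> \<le> c" and cpos: "c > 0"
    using far[OF w] e(1) unfolding c_def by linarith+
  have wP: "w - P w = c *\<^sub>R n w"
    using cpos by (simp add: n_def c_def)
  have "z = (1 - \<epsilon> / c) *\<^sub>R w + (\<epsilon> / c) *\<^sub>R P w"
  proof -
    have "(1 - \<epsilon> / c) *\<^sub>R w + (\<epsilon> / c) *\<^sub>R P w = w - (\<epsilon> / c) *\<^sub>R (w - P w)"
      by (simp add: algebra_simps)
    also have "\<dots> = w - \<epsilon> *\<^sub>R n w"
      using cpos by (simp add: wP)
    also have "\<dots> = z"
      by (metis add_diff_cancel_right' fixpt)
    finally show ?thesis ..
  qed
  then have "z \<in> closed_segment w (P w)"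
    using c cpos e unfolding closed_segment_def
    by (intro CollectI exI[of _ "\<epsilon> / c"]) (auto simp: field_simps)
  then have "P w \<in> nearest_points M z"
    using nearest_points_along_segment P_in[OF w] by blast
  then have Pw: "P w = p"
    using nearest_points_unique[OF R _ _ p] dz e by auto
  have "z - p = (c - \<epsilon>) *\<^sub>R n w"
    using wP fixpt Pw by (simp add: algebra_simps)
  then have Tu: "T *\<^sub>R u = (c - \<epsilon>) *\<^sub>R n w"
    by (simp add: zp)
  have "T = c - \<epsilon>"
    using arg_cong[OF Tu, of norm] u norm_n[OF w] c e by simp
  with Tu e have "n w = u"
    by simp
  with fixpt have "w = p + (T + \<epsilon>) *\<^sub>R u"
    by (simp add: zp algebra_simps)
  with P_in[OF w] Pw show ?thesis
    by simp
qed

text \<open>The parameters up to a given \<open>t < R\<close> for which \<open>p\<close> is nearest form a closed set, so a maximal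
  one exists; by the previous lemma it can only be \<open>t\<close> itself.\<close>

lemma nearest_point_along_ray:
  fixes M :: "'a::euclidean_space set"
  assumes M: "compact M" and R: "proximally_smooth R M"
    and p: "p \<in> nearest_points M (p + s *\<^sub>R u)" and u: "norm u = 1"
    and st: "0 < s" "s \<le> t" "t < R"
  shows "p \<in> nearest_points M (p + t *\<^sub>R u)"
proof -
  define A where "A = {t' \<in> {s..t}. p \<in> nearest_points M (p + t' *\<^sub>R u)}"
  have pM: "p \<in> M"
    using p by (simp add: nearest_points_iff)
  have "A = {s..t} \<inter> (\<Inter>y\<in>M. {t'. dist (p + t' *\<^sub>R u) p \<le> dist (p + t' *\<^sub>R u) y})"
    using pM by (auto simp: A_def nearest_points_iff)
  then have "closed A"
    by (auto intro!: closed_INT closed_Collect_le continuous_intros)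
  moreover have "s \<in> A" "bdd_above A"
    using p st by (auto simp: A_def intro: bdd_aboveI[of _ t])
  ultimately have SupA: "Sup A \<in> A" and upper: "\<And>t'. t' \<in> A \<Longrightarrow> t' \<le> Sup A"
    using closed_contains_Sup[of A] by (auto intro: cSup_upper)
  have "Sup A = t"
  proof (rule ccontr)
    assume "Sup A \<noteq> t"
    define T where "T = Sup A"
    have T: "0 < T" "s \<le> T" "T < t" "p \<in> nearest_points M (p + T *\<^sub>R u)"
      using SupA \<open>Sup A \<noteq> t\<close> st by (auto simp: A_def T_def)
    define \<epsilon> where "\<epsilon> = min (T / 2) (t - T)"
    have \<epsilon>: "0 < \<epsilon>" "2 * \<epsilon> \<le> T" "T + \<epsilon> \<le> t"
      using T by (auto simp: \<epsilon>_def min_def)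
    then have "T + \<epsilon> \<in> A"
      using nearest_point_extends[OF M R T(4) refl u \<epsilon>(1,2)] T st by (auto simp: A_def)
    then show False
      using upper \<epsilon>(1) by (fastforce simp: T_def)
  qed
  with SupA show ?thesis
    by (simp add: A_def)
qed

text \<open>The open balls of radius \<open>t < R\<close> that touch \<open>M\<close> at \<open>p\<close> from the side of \<open>x\<close> do not meet \<open>M\<close>.
  In the limit \<open>t \<rightarrow> R\<close> this is the proximal normal inequality.\<close>

lemma proximal_normal_inequality:
  fixes M :: "'a::euclidean_space set"
  assumes M: "compact M" and R: "proximally_smooth R M" "0 < R"
    and p: "p \<in> nearest_points M x" and y: "y \<in> M"
  shows "2 * R * ((x - p) \<bullet> (y - p)) \<le> norm (x - p) * (norm (y - p))\<^sup>2"
proof (cases "x = p")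
  case False
  define s where "s = norm (x - p)"
  define u where "u = (x - p) /\<^sub>R s"
  have s: "0 < s"
    using False by (simp add: s_def)
  have u: "norm u = 1" and xp: "x - p = s *\<^sub>R u"
    using s by (simp_all add: u_def s_def)
  have px: "p \<in> nearest_points M (p + s *\<^sub>R u)"
    using p by (simp flip: xp)
  have ineq: "2 * t * (u \<bullet> (y - p)) \<le> (norm (y - p))\<^sup>2" if t: "0 < t" "t < R" for t
  proof -
    have "p \<in> nearest_points M (p + t *\<^sub>R u)"
    proof (cases "s \<le> t")
      case True
      then show ?thesis
        using nearest_point_along_ray[OF M R(1) px u s True t(2)] by simp
    next
      case False
      have "p + t *\<^sub>R u = (1 - (1 - t / s)) *\<^sub>R (p + s *\<^sub>R u) + (1 - t / s) *\<^sub>R p"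
        using s by (simp add: algebra_simps)
      then have "p + t *\<^sub>R u \<in> closed_segment (p + s *\<^sub>R u) p"
        using False t s unfolding closed_segment_def
        by (intro CollectI exI[of _ "1 - t / s"]) auto
      then show ?thesis
        using nearest_points_along_segment[OF px] by blast
    qed
    then have "norm (t *\<^sub>R u) \<le> norm (t *\<^sub>R u - (y - p))"
      using y by (auto simp: nearest_points_iff dist_norm algebra_simps)
    then have "(norm (t *\<^sub>R u))\<^sup>2 \<le> (norm (t *\<^sub>R u - (y - p)))\<^sup>2"
      by (rule power_mono) simp
    then show ?thesis
      unfolding power2_norm_eq_inner by (simp add: inner_diff inner_commute algebra_simps)
  qed
  have "2 * R * (u \<bullet> (y - p)) \<le> (norm (y - p))\<^sup>2"
  proof (rule field_le_mult_one_interval)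
    fix a :: real
    assume "0 < a" "a < 1"
    then show "a * (2 * R * (u \<bullet> (y - p))) \<le> (norm (y - p))\<^sup>2"
      using ineq[of "a * R"] R(2) by (simp add: mult_ac)
  qed
  then have "s * (2 * R * (u \<bullet> (y - p))) \<le> s * (norm (y - p))\<^sup>2"
    using s by (intro mult_left_mono) auto
  then show ?thesis
    by (simp add: xp u mult_ac less_imp_le[OF s])
qed simp

text \<open>Adding the proximal normal inequalities at \<open>p\<close> and at \<open>q\<close> gives
  \<open>\<parallel>p - q\<parallel>\<^sup>2 - (x - y) \<bullet> (p - q) \<le> (\<tau> / R) \<parallel>p - q\<parallel>\<^sup>2\<close>, and Cauchy--Schwarz does the rest.\<close>

theorem nearest_points_lipschitz:
  fixes M :: "'a::euclidean_space set"
  assumes M: "compact M" and R: "proximally_smooth R M"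
    and \<tau>: "0 \<le> \<tau>" "\<tau> < R"
    and x: "infdist x M \<le> \<tau>" and y: "infdist y M \<le> \<tau>"
    and p: "p \<in> nearest_points M x" and q: "q \<in> nearest_points M y"
  shows "norm (p - q) \<le> R / (R - \<tau>) * norm (x - y)"
proof -
  define D where "D = norm (p - q)"
  have R0: "0 < R" using \<tau> by simp
  have pq: "p \<in> M" "q \<in> M" "norm (x - p) \<le> \<tau>" "norm (y - q) \<le> \<tau>"
    using p q x y by (auto simp: nearest_points_iff_infdist dist_norm)
  have "2 * R * ((x - p) \<bullet> (q - p)) \<le> norm (x - p) * (norm (q - p))\<^sup>2"
    by (intro proximal_normal_inequality[OF M R R0 p pq(2)])
  also have "\<dots> \<le> \<tau> * D\<^sup>2"
    using pq by (simp add: D_def norm_minus_commute mult_right_mono)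
  finally have 1: "2 * R * ((x - p) \<bullet> (q - p)) \<le> \<tau> * D\<^sup>2" .
  have "2 * R * ((y - q) \<bullet> (p - q)) \<le> norm (y - q) * (norm (p - q))\<^sup>2"
    by (intro proximal_normal_inequality[OF M R R0 q pq(1)])
  also have "\<dots> \<le> \<tau> * D\<^sup>2"
    using pq by (simp add: D_def mult_right_mono)
  finally have 2: "2 * R * ((y - q) \<bullet> (p - q)) \<le> \<tau> * D\<^sup>2" .
  have "(x - p) \<bullet> (q - p) + (y - q) \<bullet> (p - q) = D\<^sup>2 - (x - y) \<bullet> (p - q)"
    unfolding D_def power2_norm_eq_inner by (simp add: inner_diff inner_commute algebra_simps)
  moreover have "2 * R * ((x - p) \<bullet> (q - p) + (y - q) \<bullet> (p - q)) \<le> 2 * (\<tau> * D\<^sup>2)"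
    using 1 2 unfolding distrib_left by linarith
  ultimately have "R * (D\<^sup>2 - (x - y) \<bullet> (p - q)) \<le> \<tau> * D\<^sup>2"
    by simp
  moreover have "R * ((x - y) \<bullet> (p - q)) \<le> R * (norm (x - y) * D)"
    using R0 by (intro mult_left_mono) (auto simp: D_def norm_cauchy_schwarz)
  ultimately have "D * ((R - \<tau>) * D) \<le> D * (R * norm (x - y))"
    by (simp add: power2_eq_square algebra_simps)
  then have "(R - \<tau>) * D \<le> R * norm (x - y)"
    using R0 by (cases "D = 0") (auto simp: D_def)
  then show ?thesis
    using \<tau> by (simp add: D_def field_simps)
qed

section \<open>The second largest singular value\<close>

lemma matrix_transpose_inner:
  fixes A :: "real^'n^'n"
  shows "(A *v v) \<bullet> (A *v w) = v \<bullet> ((transpose A ** A) *v w)"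
  using dot_lmul_matrix[of v "transpose A" "A *v w"]
  by (simp add: matrix_vector_mul_assoc)

lemma gram_matrix_selfadjoint:
  fixes A :: "real^'n^'n"
  shows "v \<bullet> ((transpose A ** A) *v w) = ((transpose A ** A) *v v) \<bullet> w"
  by (metis inner_commute matrix_transpose_inner)

text \<open>Eigenvectors of \<open>A\<^sup>T A\<close> for distinct eigenvalues are orthogonal, and an orthogonal family in a
  Euclidean space is finite.\<close>

lemma finite_gram_eigenvalues:
  fixes A :: "real^'n^'n"
  shows "finite {c. eigenvalue (transpose A ** A) c}"
proof -
  define S where "S = transpose A ** A"
  define f where "f = (\<lambda>c. SOME v. v \<noteq> 0 \<and> v \<in> eigenspace S c)"
  have f: "f c \<noteq> 0" "S *v f c = c *\<^sub>R f c" if "eigenvalue S c" for c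
    using someI_ex[OF that[unfolded eigenvalue_def]] by (auto simp: f_def eigenspace_def)
  have "orthogonal (f c) (f c')" if "eigenvalue S c" "eigenvalue S c'" "c \<noteq> c'" for c c'
  proof -
    have "c' * (f c \<bullet> f c') = c * (f c \<bullet> f c')"
      using gram_matrix_selfadjoint[of "f c" A "f c'"] f that by (simp add: S_def)
    with that(3) show ?thesis
      by (simp add: orthogonal_def)
  qed
  then have "pairwise orthogonal (f ` {c. eigenvalue S c})"
    by (auto simp: pairwise_def)
  then have "finite (f ` {c. eigenvalue S c})"
    by (rule pairwise_orthogonal_imp_finite)
  moreover have "inj_on f {c. eigenvalue S c}"
  proof (rule inj_onI)
    fix c c'
    assume "c \<in> {c. eigenvalue S c}" "c' \<in> {c. eigenvalue S c}" "f c = f c'"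
    then show "c = c'"
      using f by (metis mem_Collect_eq scaleR_cancel_right)
  qed
  ultimately show ?thesis
    unfolding S_def by (rule finite_imageD)
qed

lemma count_singular_values:
  fixes A :: "real^'n^'n"
  assumes "0 \<le> s"
  shows "count (singular_values A) s = dim (eigenspace (transpose A ** A) (s\<^sup>2))"
proof -
  define E where "E = {s. 0 \<le> s \<and> eigenvalue (transpose A ** A) (s\<^sup>2)}"
  have "inj_on (\<lambda>s::real. s\<^sup>2) E"
    by (auto simp: E_def inj_on_def)
  moreover have "finite ((\<lambda>s::real. s\<^sup>2) ` E)"
    by (rule finite_subset[OF _ finite_gram_eigenvalues[of A]]) (auto simp: E_def)
  ultimately have "finite E"
    using finite_imageD by blast
  then have "count (singular_values A) s =
      (if s \<in> E then dim (eigenspace (transpose A ** A) (s\<^sup>2)) else 0)"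
    unfolding singular_values_def E_def[symmetric] by (simp add: count_sum sum.delta)
  moreover have "dim (eigenspace (transpose A ** A) (s\<^sup>2)) = 0" if "s \<notin> E"
    using that assms by (auto simp: E_def eigenvalue_def)
  ultimately show ?thesis
    by auto
qed

lemma min_le_second_largest:
  fixes a b :: real
  assumes "{#a, b#} \<subseteq># N"
  shows "min a b \<le> rev (sorted_list_of_multiset N) ! 1"
proof (rule ccontr)
  assume neg: "\<not> ?thesis"
  define xs where "xs = rev (sorted_list_of_multiset N)"
  define c where "c = min a b"
  have N: "mset xs = N" and sorted: "sorted_wrt (\<ge>) xs"
    by (simp_all add: xs_def sorted_wrt_rev)
  have "2 \<le> length xs"
    using size_mset_mono[OF assms] by (simp flip: N)
  then obtain x y ys where xs: "xs = x # y # ys"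
    by (metis One_nat_def Suc_1 Suc_le_length_iff)
  then have "y < c" "\<forall>z\<in>set ys. z \<le> y"
    using neg sorted by (auto simp: c_def xs_def)
  then have "filter (\<lambda>z. c \<le> z) (y # ys) = []"
    by (auto simp: filter_empty_conv)
  then have "length (filter (\<lambda>z. c \<le> z) xs) \<le> 1"
    by (simp add: xs)
  then have "size (filter_mset (\<lambda>z. c \<le> z) N) \<le> 1"
    by (simp flip: N mset_filter)
  moreover have "size (filter_mset (\<lambda>z. c \<le> z) {#a, b#}) \<le> size (filter_mset (\<lambda>z. c \<le> z) N)"
    by (intro size_mset_mono multiset_filter_mono assms)
  ultimately show False
    by (simp add: c_def)
qed

text \<open>Singular values are counted with multiplicity.  If \<open>s = t\<close> the orthogonal vectors \<open>v\<close> and \<open>w\<close>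
  lie in one eigenspace, which then has dimension at least two.\<close>

lemma second_singular_value_ge:
  fixes A :: "real^'n^'n"
  assumes st: "0 \<le> s" "0 \<le> t"
    and v: "v \<noteq> 0" "v \<in> eigenspace (transpose A ** A) (s\<^sup>2)"
    and w: "w \<noteq> 0" "w \<in> eigenspace (transpose A ** A) (t\<^sup>2)"
    and orth: "v \<bullet> w = 0"
  shows "min s t \<le> second_singular_value A"
proof -
  define S where "S = transpose A ** A"
  have card_le: "card B \<le> dim (eigenspace S c)"
    if B: "B \<subseteq> {v, w}" "B \<subseteq> eigenspace S c" for B c
  proof -
    have "pairwise orthogonal {v, w}"
      using orth by (auto simp: pairwise_def orthogonal_def inner_commute)
    then have "pairwise orthogonal B" "0 \<notin> B"
      using B(1) v w by (auto intro: pairwise_subset)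
    then show ?thesis
      using pairwise_orthogonal_independent independent_card_le_dim B(2) by blast
  qed
  have "v \<noteq> w"
    using orth v by auto
  have "{#s, t#} \<subseteq># singular_values A"
  proof (cases "s = t")
    case True
    then have "2 \<le> count (singular_values A) s"
      using card_le[of "{v, w}" "s\<^sup>2"] v w \<open>v \<noteq> w\<close> st
      by (simp add: count_singular_values S_def)
    then show ?thesis
      using True by (auto simp: subseteq_mset_def)
  next
    case False
    have "1 \<le> count (singular_values A) s" "1 \<le> count (singular_values A) t"
      using card_le[of "{v}" "s\<^sup>2"] card_le[of "{w}" "t\<^sup>2"] v w st
      by (simp_all add: count_singular_values S_def)
    with False show ?thesis
      by (auto simp: subseteq_mset_def)
  qed
  then show ?thesis
    unfolding second_singular_value_def by (rule min_le_second_largest)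
qed

text \<open>The variational step of the spectral theorem: a maximiser \<open>v\<close> of \<open>\<parallel>A v\<parallel>\<close> on the unit sphere of
  an invariant subspace is an eigenvector of \<open>A\<^sup>T A\<close>.  Otherwise, with \<open>s\<close> the maximum, the quadratic
  form \<open>s\<^sup>2 \<parallel>w\<parallel>\<^sup>2 - \<parallel>A w\<parallel>\<^sup>2\<close>, which is nonnegative on the subspace and zero at \<open>v\<close>, would become
  negative at a small step from \<open>v\<close> in the direction of the residual \<open>A\<^sup>T A v - s\<^sup>2 v\<close>.\<close>

lemma gram_eigenvector_exists:
  fixes A :: "real^'n^'n"
  assumes V: "subspace V" and inv: "\<And>v. v \<in> V \<Longrightarrow> (transpose A ** A) *v v \<in> V"
    and nontrivial: "w\<^sub>0 \<in> V" "w\<^sub>0 \<noteq> 0"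
  obtains v s where "0 \<le> s" "v \<in> V" "v \<noteq> 0" "v \<in> eigenspace (transpose A ** A) (s\<^sup>2)"
    and "\<And>w. w \<in> V \<Longrightarrow> norm (A *v w) \<le> s * norm w"
proof -
  define S where "S = transpose A ** A"
  define K where "K = V \<inter> sphere 0 1"
  have "compact K"
    unfolding K_def by (intro closed_Int_compact closed_subspace V compact_sphere)
  moreover have unit: "w /\<^sub>R norm w \<in> K" if "w \<in> V" "w \<noteq> 0" for w
    using that V by (auto simp: K_def subspace_scale)
  then have "K \<noteq> {}"
    using nontrivial by blast
  moreover have "continuous_on K (\<lambda>v. norm (A *v v))"
    by (intro continuous_intros matrix_vector_mult_linear_continuous_on)
  ultimately obtain v where v: "v \<in> K" and max: "\<And>w. w \<in> K \<Longrightarrow> norm (A *v w) \<le> norm (A *v v)"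
    using continuous_attains_sup[of K "\<lambda>v. norm (A *v v)"] by blast
  have vV: "v \<in> V" and nv: "norm v = 1"
    using v by (auto simp: K_def)
  define s where "s = norm (A *v v)"
  have bound: "norm (A *v w) \<le> s * norm w" if "w \<in> V" for w
  proof (cases "w = 0")
    case False
    have "A *v w = norm w *\<^sub>R (A *v (w /\<^sub>R norm w))"
      using False by (simp add: matrix_vector_mult_scaleR)
    then show ?thesis
      using mult_left_mono[OF max[OF unit[OF that False]], of "norm w"]
      by (simp add: s_def mult.commute)
  qed simp
  define g where "g = S *v v - s\<^sup>2 *\<^sub>R v"
  have gV: "g \<in> V"
    unfolding g_def S_def using V inv vV by (simp add: subspace_diff subspace_scale)
  have norm_sq: "(norm (a + t *\<^sub>R b))\<^sup>2 = (norm a)\<^sup>2 + 2 * t * (a \<bullet> b) + t\<^sup>2 * (norm b)\<^sup>2"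
    for a b :: "real^'n" and t
    unfolding power2_norm_eq_inner
    by (simp add: inner_add_left inner_add_right inner_commute[of b a]
        power2_eq_square algebra_simps)
  define C where "C = s\<^sup>2 * (norm g)\<^sup>2 - (norm (A *v g))\<^sup>2"
  have quad: "2 * (norm g)\<^sup>2 \<le> t * C" if t: "0 < t" for t
  proof -
    have "v + t *\<^sub>R g \<in> V"
      using V vV gV by (simp add: subspace_add subspace_scale)
    then have "(norm (A *v (v + t *\<^sub>R g)))\<^sup>2 \<le> (s * norm (v + t *\<^sub>R g))\<^sup>2"
      by (intro power_mono bound) auto
    also have "(norm (A *v (v + t *\<^sub>R g)))\<^sup>2 =
        s\<^sup>2 + 2 * t * ((A *v v) \<bullet> (A *v g)) + t\<^sup>2 * (norm (A *v g))\<^sup>2"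
      by (simp add: s_def matrix_vector_right_distrib matrix_vector_mult_scaleR norm_sq)
    also have "(A *v v) \<bullet> (A *v g) = (norm g)\<^sup>2 + s\<^sup>2 * (v \<bullet> g)"
    proof -
      have "(A *v v) \<bullet> (A *v g) = (S *v v) \<bullet> g"
        unfolding S_def by (simp add: matrix_transpose_inner gram_matrix_selfadjoint)
      also have "S *v v = g + s\<^sup>2 *\<^sub>R v"
        by (simp add: g_def)
      finally show ?thesis
        by (simp add: inner_simps power2_norm_eq_inner)
    qed
    also have "(s * norm (v + t *\<^sub>R g))\<^sup>2 = s\<^sup>2 * (1 + 2 * t * (v \<bullet> g) + t\<^sup>2 * (norm g)\<^sup>2)"
      by (simp add: power_mult_distrib norm_sq nv)
    finally have "t * (2 * (norm g)\<^sup>2) \<le> t * (t * C)"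
      by (simp add: C_def power2_eq_square algebra_simps)
    with t show ?thesis
      by simp
  qed
  have "2 * (norm g)\<^sup>2 \<le> 0"
  proof (rule field_le_epsilon)
    fix e :: real
    assume e: "0 < e"
    have "(e / (\<bar>C\<bar> + 1)) * C \<le> e"
      using e mult_left_mono[of C "\<bar>C\<bar> + 1" "e / (\<bar>C\<bar> + 1)"] by simp
    moreover have "0 < e / (\<bar>C\<bar> + 1)"
      using e by simp
    ultimately show "2 * (norm g)\<^sup>2 \<le> 0 + e"
      using quad by force
  qed
  then have "v \<in> eigenspace (transpose A ** A) (s\<^sup>2)"
    by (simp add: g_def S_def eigenspace_def)
  then show ?thesis
    using that[of s v] vV nv bound by (force simp: s_def)
qed

text \<open>The constant vectors belong to the singular value \<open>1\<close>, so the norm of \<open>W\<close> on their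
  orthogonal complement is a further singular value \<open>s\<close>.  Hence \<open>min 1 s\<close> is at most the second largest one,
  and as the latter is less than \<open>1\<close>, this minimum is \<open>s\<close>.\<close>

lemma doubly_stochastic_contraction:
  fixes W :: "real^'n^'n"
  assumes W: "doubly_stochastic W" and \<sigma>: "second_singular_value W < 1"
    and v: "(\<Sum>i\<in>UNIV. v $ i) = 0"
  shows "norm (W *v v) \<le> second_singular_value W * norm v"
proof (cases "v = 0")
  case False
  define V where "V = {w::real^'n. 1 \<bullet> w = 0}"
  have one: "(transpose W ** W) *v 1 = 1"
  proof -
    have "W *v 1 = 1" "transpose W *v 1 = 1"
      using W by (simp_all add: vec_eq_iff matrix_vector_mult_def transpose_def doubly_stochastic_def)
    then show ?thesis
      by (simp flip: matrix_vector_mul_assoc)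
  qed
  have "subspace V"
    unfolding V_def by (rule subspace_hyperplane)
  moreover have "(transpose W ** W) *v w \<in> V" if "w \<in> V" for w
    using that by (simp add: V_def gram_matrix_selfadjoint one)
  moreover have vV: "v \<in> V"
    using v by (simp add: V_def inner_vec_def)
  ultimately obtain e s where s: "0 \<le> s" and e: "e \<in> V" "e \<noteq> 0"
      "e \<in> eigenspace (transpose W ** W) (s\<^sup>2)"
    and bound: "\<And>w. w \<in> V \<Longrightarrow> norm (W *v w) \<le> s * norm w"
    using gram_eigenvector_exists[of V W v] False by metis
  have "min 1 s \<le> second_singular_value W"
    using e s one by (intro second_singular_value_ge[of 1 s 1 W e]) (auto simp: V_def eigenspace_def)
  then have "s \<le> second_singular_value W"
    using \<sigma> by linarith
  then show ?thesis
    using bound[OF vV] mult_right_mono[of s "second_singular_value W" "norm v"] by simp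
qed simp

section \<open>Averaging stacked vectors\<close>

lemma power2_norm_stack:
  fixes x :: "'a::euclidean_space^'n"
  shows "(norm x)\<^sup>2 = (\<Sum>i\<in>UNIV. (norm (x $ i))\<^sup>2)"
  by (simp add: norm_vec_def L2_set_def sum_nonneg)

lemma power2_norm_Basis:
  fixes z :: "'a::euclidean_space"
  shows "(norm z)\<^sup>2 = (\<Sum>b\<in>Basis. (z \<bullet> b)\<^sup>2)"
  unfolding power2_norm_eq_inner euclidean_inner[of z z] by (simp add: power2_eq_square)

lemma sum_minus_average:
  fixes x :: "'a::euclidean_space^'n"
  shows "(\<Sum>i\<in>UNIV. x $ i - average x) = 0"
  by (simp add: sum_subtractf average_def sum_constant_scaleR)

lemma power2_norm_minus_constant:
  fixes x :: "'a::euclidean_space^'n"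
  shows "(norm (x - (\<chi> i. y)))\<^sup>2 =
    (norm (x - (\<chi> i. average x)))\<^sup>2 + real CARD('n) * (norm (average x - y))\<^sup>2"
proof -
  define a where "a = average x"
  have pointwise: "(norm (x $ i - y))\<^sup>2 =
      (norm (x $ i - a))\<^sup>2 + 2 * ((x $ i - a) \<bullet> (a - y)) + (norm (a - y))\<^sup>2" for i
    unfolding power2_norm_eq_inner by (simp add: inner_diff inner_commute algebra_simps)
  have "(\<Sum>i\<in>UNIV. (x $ i - a) \<bullet> (a - y)) = 0"
    unfolding inner_sum_left[symmetric] a_def sum_minus_average by simp
  then show ?thesis
    unfolding a_def[symmetric] power2_norm_stack
    by (simp add: pointwise sum.distrib flip: sum_distrib_left)
qed

lemma norm_minus_constant_mono:
  fixes x :: "'a::euclidean_space^'n"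
  assumes "norm (average x - y) \<le> norm (average x - z)"
  shows "norm (x - (\<chi> i. y)) \<le> norm (x - (\<chi> i. z))"
proof (rule power2_le_imp_le)
  show "(norm (x - (\<chi> i. y)))\<^sup>2 \<le> (norm (x - (\<chi> i. z)))\<^sup>2"
    unfolding power2_norm_minus_constant[of x y] power2_norm_minus_constant[of x z]
    using assms by (intro add_left_mono mult_left_mono power_mono) auto
qed simp

lemma norm_average_minus_le:
  fixes x :: "'a::euclidean_space^'n"
  shows "norm (average x - y) \<le> norm (x - (\<chi> i. y))"
proof (rule power2_le_imp_le)
  have "1 * (norm (average x - y))\<^sup>2 \<le> real CARD('n) * (norm (average x - y))\<^sup>2"
    by (intro mult_right_mono) (auto simp: Suc_le_eq)
  then show "(norm (average x - y))\<^sup>2 \<le> (norm (x - (\<chi> i. y)))\<^sup>2"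
    unfolding power2_norm_minus_constant[of x y] by (simp add: add_increasing)
qed simp

lemma norm_stack_mono:
  fixes x y :: "'a::euclidean_space^'n"
  assumes "\<And>i. norm (x $ i) \<le> norm (y $ i)"
  shows "norm x \<le> norm y"
  unfolding norm_vec_def using assms by (intro L2_set_mono) auto

lemma norm_block_minus_le:
  fixes x :: "'a::euclidean_space^'n"
  shows "norm (x $ i - y) \<le> norm (x - (\<chi> i. y))"
  using Finite_Cartesian_Product.norm_nth_le[of "x - (\<chi> i. y)" i] by simp

text \<open>For each basis vector \<open>b\<close> the coordinates \<open>u\<^sub>i \<bullet> b\<close> form a real vector with entries summing to
  zero, on which \<open>W\<close> acts as an ordinary matrix; the squared norm of a stack is the sum over \<open>b\<close> of the
  squared norms of these vectors.\<close>

lemma mixing_contraction_zero_sum: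
  fixes W :: "real^'n^'n" and u :: "'a::euclidean_space^'n"
  assumes W: "doubly_stochastic W" "0 \<le> second_singular_value W" "second_singular_value W < 1"
    and u: "(\<Sum>i\<in>UNIV. u $ i) = 0"
  shows "norm (\<chi> i. \<Sum>j\<in>UNIV. W $ i $ j *\<^sub>R u $ j) \<le> second_singular_value W * norm u"
proof (rule power2_le_imp_le)
  define \<sigma> where "\<sigma> = second_singular_value W"
  define coord :: "'a^'n \<Rightarrow> 'a \<Rightarrow> real^'n" where "coord = (\<lambda>y b. \<chi> i. y $ i \<bullet> b)"
  define Wu where "Wu = (\<chi> i. \<Sum>j\<in>UNIV. W $ i $ j *\<^sub>R u $ j)"
  have coords: "(norm y)\<^sup>2 = (\<Sum>b\<in>Basis. (norm (coord y b))\<^sup>2)" for y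
    unfolding power2_norm_stack power2_norm_Basis[where 'a='a]
    by (subst sum.swap) (simp add: coord_def)
  have coord_Wu: "coord Wu b = W *v coord u b" for b
    by (simp add: coord_def Wu_def matrix_vector_mult_def vec_eq_iff inner_sum_left)
  have "norm (coord Wu b) \<le> \<sigma> * norm (coord u b)" for b
  proof -
    have "(\<Sum>i\<in>UNIV. coord u b $ i) = 0"
      using u by (simp add: coord_def flip: inner_sum_left)
    then show ?thesis
      unfolding \<sigma>_def coord_Wu by (rule doubly_stochastic_contraction[OF W(1,3)])
  qed
  then have "(norm (coord Wu b))\<^sup>2 \<le> (\<sigma> * norm (coord u b))\<^sup>2" for b
    by (intro power_mono) auto
  then have "(norm Wu)\<^sup>2 \<le> (\<Sum>b\<in>Basis. (\<sigma> * norm (coord u b))\<^sup>2)"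
    unfolding coords by (intro sum_mono)
  also have "\<dots> = (\<sigma> * norm u)\<^sup>2"
    by (simp add: power_mult_distrib coords flip: sum_distrib_left)
  finally show "(norm (\<chi> i. \<Sum>j\<in>UNIV. W $ i $ j *\<^sub>R u $ j))\<^sup>2 \<le> (second_singular_value W * norm u)\<^sup>2"
    by (simp add: Wu_def \<sigma>_def)
qed (use W in simp)

lemma mixing_contraction:
  fixes W :: "real^'n^'n" and x :: "'a::euclidean_space^'n"
  assumes W: "doubly_stochastic W" "0 \<le> second_singular_value W" "second_singular_value W < 1"
  shows "norm ((\<chi> i. \<Sum>j\<in>UNIV. W $ i $ j *\<^sub>R x $ j) - (\<chi> i. average x))
    \<le> second_singular_value W * norm (x - (\<chi> i. average x))"
proof -
  define u where "u = x - (\<chi> i. average x)"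
  have "(\<Sum>j\<in>UNIV. W $ i $ j) = 1" for i
    using W(1) by (simp add: doubly_stochastic_def)
  then have "(\<chi> i. \<Sum>j\<in>UNIV. W $ i $ j *\<^sub>R x $ j) - (\<chi> i. average x)
      = (\<chi> i. \<Sum>j\<in>UNIV. W $ i $ j *\<^sub>R u $ j)"
    by (simp add: vec_eq_iff u_def scaleR_diff_right sum_subtractf flip: scaleR_left.sum)
  moreover have "(\<Sum>i\<in>UNIV. u $ i) = 0"
    by (simp add: u_def sum_minus_average)
  ultimately show ?thesis
    using mixing_contraction_zero_sum[OF W, of u] unfolding u_def by metis
qed

section \<open>Invariance of the neighborhood\<close>

text \<open>The bound on the search directions enters through \<open>2 * (R - \<delta>) \<ge> R + \<delta>\<close>, which is
  where \<open>\<delta> \<le> R / 3\<close> is used: it turns the bound into \<open>(R + \<delta>) * e \<le> (R * c - \<delta>) * \<delta>\<close>, which is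
  the claim after clearing the denominator.\<close>

lemma expansion_absorbed:
  fixes R c \<delta> e :: real
  assumes \<delta>: "0 \<le> \<delta>" "3 * \<delta> \<le> R" and e: "0 \<le> e" "\<delta> + e < R"
    and bound: "e \<le> (R * c - \<delta>) / (2 * (R - \<delta>)) * \<delta>"
  shows "R / (R - (\<delta> + e)) * ((1 - c) * \<delta> + e) \<le> \<delta>"
proof -
  have "(R + \<delta>) * e \<le> 2 * (R - \<delta>) * e"
    using \<delta> e by (intro mult_right_mono) auto
  also have "\<dots> \<le> (R * c - \<delta>) * \<delta>"
    using mult_left_mono[OF bound, of "2 * (R - \<delta>)"] \<delta> e by simp
  finally have "R * ((1 - c) * \<delta> + e) \<le> \<delta> * (R - (\<delta> + e))"
    by (simp add: algebra_simps)
  then show ?thesis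
    using e by (simp add: pos_divide_le_eq)
qed

text \<open>The average and all the perturbed mixtures are within \<open>\<delta> + \<parallel>v\<parallel>\<close> of \<open>M\<close>, so the projection expands
  their distances by at most \<open>R / (R - (\<delta> + \<parallel>v\<parallel>))\<close>.  Comparing the new iterates with the old consensus
  point \<open>xbar\<close>, which is itself the projection of the old average, is enough: the new consensus point
  is at least as close to the new iterates as any other point of \<open>M\<close>.\<close>

lemma neighborhood_step:
  fixes M :: "'a::euclidean_space set" and W :: "real^'n^'n" and x x' v :: "'a^'n"
  assumes M: "compact M" "proximally_smooth R M"
    and W: "doubly_stochastic W" "0 \<le> second_singular_value W" "second_singular_value W < 1"
    and \<gamma>: "0 \<le> \<gamma>" "\<gamma> \<le> 1"
    and x: "x \<in> neighborhood M \<delta>"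
    and x': "\<And>i. x' $ i \<in> nearest_points M
      ((1 - \<gamma>) *\<^sub>R x $ i + \<gamma> *\<^sub>R (\<Sum>j\<in>UNIV. W $ i $ j *\<^sub>R x $ j) + v $ i)"
    and \<delta>: "3 * \<delta> \<le> R" "\<delta> + norm v < R"
    and v: "norm v \<le> (R * (\<gamma> * (1 - second_singular_value W)) - \<delta>) / (2 * (R - \<delta>)) * \<delta>"
  shows "x' \<in> neighborhood M \<delta>"
proof -
  define \<sigma> where "\<sigma> = second_singular_value W"
  define \<tau> where "\<tau> = \<delta> + norm v"
  define a where "a = average x"
  define m where "m = (1 - \<gamma>) *\<^sub>R x + \<gamma> *\<^sub>R (\<chi> i. \<Sum>j\<in>UNIV. W $ i $ j *\<^sub>R x $ j)"
  obtain xbar where xbar: "xbar \<in> nearest_points M a" and near: "norm (x - (\<chi> i. xbar)) \<le> \<delta>"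
    using x by (auto simp: neighborhood_def a_def)
  have xbarM: "xbar \<in> M"
    using xbar by (simp add: nearest_points_iff)
  have \<delta>0: "0 \<le> \<delta>"
    using near norm_ge_zero order_trans by blast
  have R: "0 < R" "\<tau> < R"
    using \<delta>(2) \<delta>0 norm_ge_zero[of v] unfolding \<tau>_def by linarith+
  have block: "norm (x $ j - xbar) \<le> \<delta>" for j
    using norm_block_minus_le[of x j xbar] near by simp
  have avg_near: "norm (a - xbar) \<le> \<delta>"
    using norm_average_minus_le[of x xbar] near by (simp add: a_def)
  have x'_nearest: "x' $ i \<in> nearest_points M (m $ i + v $ i)" for i
    using x'[of i] by (simp add: m_def)

  \<comment> \<open>A mixture is a convex combination of blocks, so it stays in the ball of radius \<open>\<delta>\<close> around
    \<open>xbar\<close>, which contains all of them.\<close>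
  have "infdist a M \<le> \<tau>"
    using avg_near by (intro infdist_le2[OF xbarM]) (simp add: \<tau>_def dist_norm add_increasing2)
  moreover have "infdist (m $ i + v $ i) M \<le> \<tau>" for i
  proof (rule infdist_le2[OF xbarM])
    have rows: "(\<Sum>j\<in>UNIV. W $ i $ j) = 1" "\<And>j. 0 \<le> W $ i $ j"
      using W(1) by (auto simp: doubly_stochastic_def)
    have "(\<Sum>j\<in>UNIV. W $ i $ j *\<^sub>R x $ j) \<in> cball xbar \<delta>"
      using rows block by (intro convex_sum) (auto simp: dist_norm norm_minus_commute)
    then have "m $ i \<in> cball xbar \<delta>"
      using \<gamma> block[of i] convexD[OF convex_cball[of xbar \<delta>], of "x $ i" _ "1 - \<gamma>" \<gamma>]
      by (simp add: m_def dist_norm norm_minus_commute)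
    moreover have "norm (v $ i) \<le> norm v"
      by (rule Finite_Cartesian_Product.norm_nth_le)
    ultimately show "dist (m $ i + v $ i) xbar \<le> \<tau>"
      using norm_triangle_ineq[of "m $ i - xbar" "v $ i"]
      by (simp add: \<tau>_def dist_norm norm_minus_commute algebra_simps)
  qed
  ultimately have lip: "norm (x' $ i - xbar) \<le> R / (R - \<tau>) * norm (m $ i + v $ i - a)" for i
    using \<delta>0 \<delta>(2) x'_nearest xbar
    by (intro nearest_points_lipschitz[OF M]) (auto simp: \<tau>_def)

  have "norm (x' - (\<chi> i. xbar)) \<le> norm ((R / (R - \<tau>)) *\<^sub>R (m + v - (\<chi> i. a)))"
    using lip R by (intro norm_stack_mono) simp
  also have "\<dots> = R / (R - \<tau>) * norm (m + v - (\<chi> i. a))"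
    using R by simp
  also have "norm (m + v - (\<chi> i. a)) \<le> (1 - \<gamma> * (1 - \<sigma>)) * \<delta> + norm v"
  proof -
    have "norm (x - (\<chi> i. a)) \<le> norm (x - (\<chi> i. xbar))"
      unfolding a_def by (rule norm_minus_constant_mono) simp
    then have dev: "norm (x - (\<chi> i. a)) \<le> \<delta>"
      using near by simp
    have split: "m + v - (\<chi> i. a) = (1 - \<gamma>) *\<^sub>R (x - (\<chi> i. a))
        + \<gamma> *\<^sub>R ((\<chi> i. \<Sum>j\<in>UNIV. W $ i $ j *\<^sub>R x $ j) - (\<chi> i. a)) + v"
      by (simp add: m_def algebra_simps)
    have "norm (m + v - (\<chi> i. a)) \<le> norm ((1 - \<gamma>) *\<^sub>R (x - (\<chi> i. a)))
        + norm (\<gamma> *\<^sub>R ((\<chi> i. \<Sum>j\<in>UNIV. W $ i $ j *\<^sub>R x $ j) - (\<chi> i. a))) + norm v"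
      unfolding split by (intro norm_triangle_le add_right_mono norm_triangle_ineq)
    then have "norm (m + v - (\<chi> i. a)) \<le> (1 - \<gamma>) * norm (x - (\<chi> i. a))
        + \<gamma> * norm ((\<chi> i. \<Sum>j\<in>UNIV. W $ i $ j *\<^sub>R x $ j) - (\<chi> i. a)) + norm v"
      using \<gamma> by simp
    also have "\<dots> \<le> (1 - \<gamma>) * norm (x - (\<chi> i. a)) + \<gamma> * (\<sigma> * norm (x - (\<chi> i. a))) + norm v"
      using \<gamma> mixing_contraction[OF W, of x]
      by (intro add_mono mult_left_mono order_refl) (auto simp: a_def \<sigma>_def)
    also have "\<dots> = (1 - \<gamma> * (1 - \<sigma>)) * norm (x - (\<chi> i. a)) + norm v"
      by (simp add: algebra_simps)
    also have "\<dots> \<le> (1 - \<gamma> * (1 - \<sigma>)) * \<delta> + norm v"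
      using W(2,3) \<gamma> dev mult_le_one[of \<gamma> "1 - \<sigma>"]
      by (intro add_mono mult_left_mono order_refl) (auto simp: \<sigma>_def)
    finally show ?thesis .
  qed
  also have "R / (R - \<tau>) * ((1 - \<gamma> * (1 - \<sigma>)) * \<delta> + norm v) \<le> \<delta>"
    unfolding \<tau>_def
    using \<delta> \<delta>0 v norm_ge_zero[of v] by (intro expansion_absorbed) (auto simp: \<sigma>_def)
  finally have close: "norm (x' - (\<chi> i. xbar)) \<le> \<delta>"
    using R by (simp add: mult_left_mono divide_right_mono)

  obtain xbar' where xbar': "xbar' \<in> nearest_points M (average x')"
    using nearest_points_nonempty[OF M(1)] xbarM by blast
  then have "norm (x' - (\<chi> i. xbar')) \<le> norm (x' - (\<chi> i. xbar))"
    using xbarM by (intro norm_minus_constant_mono) (auto simp: nearest_points_iff dist_norm)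
  with close have "norm (x' - (\<chi> i. xbar')) \<le> \<delta>"
    by simp
  moreover have "x' $ i \<in> M" for i
    using x'_nearest[of i] by (simp add: nearest_points_iff)
  ultimately show ?thesis
    using xbar' unfolding neighborhood_def by blast
qed

theorem lemma3p2:
  fixes M :: "(real^'r^'d) set"
    and R \<gamma> \<eta> \<delta> \<sigma>\<^sub>2 :: real
    and E :: "'n::finite \<Rightarrow> 'n \<Rightarrow> bool"
    and W :: "real^'n^'n"
    and x d :: "nat \<Rightarrow> (real^'r^'d)^'n"
  assumes "compact M" and "smooth_embedded_submanifold M"
    and "R > 0" and "proximally_smooth R M"
    and "mixing_matrix E W" and "\<sigma>\<^sub>2 = second_singular_value W"
    and "0 < \<gamma>" and "\<gamma> \<le> 1" and "\<eta> > 0"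
    and "\<And>k i. x (Suc k) $ i \<in> nearest_points M
           ((1 - \<gamma>) *\<^sub>R x k $ i + \<gamma> *\<^sub>R (\<Sum>j\<in>UNIV. W $ i $ j *\<^sub>R x k $ j) + \<eta> *\<^sub>R d k $ i)"
    and "x 0 \<in> neighborhood M \<delta>"
    and "\<delta> < min (R * \<gamma> * (1 - \<sigma>\<^sub>2)) (R / 4)"
    and "\<And>k. norm (\<eta> *\<^sub>R d k) \<le> min (R / 4) ((R * \<gamma> * (1 - \<sigma>\<^sub>2) - \<delta>) / (2 * (R - \<delta>)) * \<delta>)"
  shows "\<forall>k. x k \<in> neighborhood M \<delta>"
proof
  fix k
  have W: "doubly_stochastic W" "0 \<le> second_singular_value W" "second_singular_value W < 1"
    using assms(5) by (auto simp: mixing_matrix_def)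
  show "x k \<in> neighborhood M \<delta>"
  proof (induction k)
    case 0
    show ?case by fact
  next
    case (Suc k)
    have v: "norm (\<eta> *\<^sub>R d k) \<le> R / 4"
      "norm (\<eta> *\<^sub>R d k) \<le> (R * \<gamma> * (1 - \<sigma>\<^sub>2) - \<delta>) / (2 * (R - \<delta>)) * \<delta>"
      using assms(13)[of k] by simp_all
    show ?case
    proof (rule neighborhood_step[OF assms(1,4) W _ assms(8) Suc, where v = "\<eta> *\<^sub>R d k"])
      show "x (Suc k) $ i \<in> nearest_points M ((1 - \<gamma>) *\<^sub>R x k $ i
          + \<gamma> *\<^sub>R (\<Sum>j\<in>UNIV. W $ i $ j *\<^sub>R x k $ j) + (\<eta> *\<^sub>R d k) $ i)" for i
        using assms(10)[of k i] by simp
      show "3 * \<delta> \<le> R" "\<delta> + norm (\<eta> *\<^sub>R d k) < R"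
        using assms(3,12) v(1) by auto
      show "norm (\<eta> *\<^sub>R d k)
          \<le> (R * (\<gamma> * (1 - second_singular_value W)) - \<delta>) / (2 * (R - \<delta>)) * \<delta>"
        using v(2) by (simp add: assms(6) mult.assoc)
    qed (use assms(7) in simp)
  qed
qed

end
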